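(* Assume the decay of correlations assumption (DC) stated in the context. Let $g_j:\mathcal Y_j\to\mathbb R$, $j\ge0$, be a sequence of real-valued functions, let $r\in B$ be nonnegative with $\int r\,d\mu=1$, and let $d\nu=r\,d\mu$. Set $G_k=g_k\circ\overline X_k$ and $S_n=\sum_{k=0}^{n-1}G_k$, and let $S_{n,\mu}$ and $S_{n,\nu}$ denote the random variable $S_n=S_n(x)$ when $x$ is distributed according to $\mu$ and $\nu$, respectively; set $b_{n,\mu}=\sqrt{\mathrm{Var}(S_{n,\mu})}$ and $b_{n,\nu}=\sqrt{\mathrm{Var}(S_{n,\nu})}$. Assume that $\int G_k\,d\mu=0$ for all $k$. Suppose also that $\delta_k=C_1\delta^k$ for some $C_1>0$ and $\delta\in(0,1)$, and that $G_k,\ r\cdot G_k\in B$ with $$\max(\|G_k\|,\|r\cdot G_k\|)\le b\,\delta^{-ak}\quad\text{for some }a,b>0\text{ and all }k\ge0.$$ Moreover, assume that there are $c_0,C_0>0$, $\beta\in(0,1)$ and $p>3$ such that $\|G_k\|_{L^p(\mu)}\le C_0e^{c_0k^\beta}$ for all $k\ge0$, and $\|r\|_{L^p(\mu)}<\infty$. Then there is $C>0$ such that for every $n\ge1$, $$\left|\mathbb E[S_{n,\mu}^2]-\mathbb E[S_{n,\nu}^2]\right|\le C.$$ Therefore, $$\left|\mathrm{Var}(S_{n,\mu})-\mathrm{Var}(S_{n,\nu})\right|\le C+\mathcal M_n^2,$$ where $$\mathcal M_n=\sum_{j=0}^{n-1}\left(M_j\delta_j+\|G_j\|_{L^{p_2}(\mu)}^{1+p_2/p_3}M_j^{-p_2/p_3}\right)$$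 for a sequence $(M_j)$ of positive numbers and exponents $p_1,p_2,p_3\ge1$ (where $p_1=\infty$ is allowed, with $\frac1\infty=0$) satisfying $\frac1{p_1}+\frac1{p_2}+\frac1{p_3}=1$ and $\|r\|_{L^{p_1}(\mu)}<\infty$. Hence, when $\mathcal M_n=o(b_{n,\mu})$ and $b_{n,\mu}\to\infty$ as $n\to\infty$, we have $$\lim_{n\to\infty}\frac{b_{n,\mu}}{b_{n,\nu}}=1,$$ and therefore $(S_{n,\mu}-\mathbb E[S_{n,\mu}])/b_{n,\mu}$ converges in distribution if and only if $(S_{n,\nu}-\mathbb E[S_{n,\nu}])/b_{n,\nu}$ converges in distribution, and to the same limit.
   Context: $(\mathcal E,\mathcal F,\mu)$ is a probability space, $\mathcal X_0,\mathcal X_1,\dots$ are measurable spaces, and $X_j:\mathcal E\to\mathcal X_j$, $j\ge0$, are measurable maps. Set $\mathcal Y_n=\mathcal X_n\times\mathcal X_{n+1}\times\cdots$ and $\overline X_n(x)=(X_n(x),X_{n+1}(x),X_{n+2}(x),\dots)\in\mathcal Y_n$. Assumption (DC): there is a sequence $(\delta_n)$ converging to $0$ and a set $B$ of real integrable functions on $\mathcal E$ equipped with a "norm" $\|\cdot\|$ such that for all $n$, all $s\in B$ and all bounded complex-valued functions $f=f(x_n,x_{n+1},\dots)$ on $\mathcal Y_n$, $$\left|\int s\cdot (f\circ\overline X_n)\,d\mu-\int s\,d\mu\cdot\int f\circ\overline X_n\,d\mu\right|\le \|s\|\,\|f\circ\overline X_n\|_{\infty}\,\delta_n,$$ where $\|f\circ\overline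 X_n\|_\infty$ is the essential supremum with respect to $\mu$. *)

theory Defs
  imports "HOL-Probability.Probability"
begin

text \<open>
  The state spaces are given as measurable spaces \<open>XX j\<close> on subsets of one ambient type \<open>'x\<close>
  (their \<open>space\<close>s may differ with \<open>j\<close>). The tail space of sequences
  \<open>(x_n, x_{n+1}, ...)\<close> is indexed from \<open>0\<close>: coordinate \<open>i\<close> holds \<open>x_{n+i}\<close>.
\<close>

definition tail_space :: "(nat \<Rightarrow> 'x measure) \<Rightarrow> nat \<Rightarrow> (nat \<Rightarrow> 'x) measure" where
  "tail_space XX n = PiM UNIV (\<lambda>i. XX (n + i))"

definition tail_map :: "(nat \<Rightarrow> 'e \<Rightarrow> 'x) \<Rightarrow> nat \<Rightarrow> 'e \<Rightarrow> nat \<Rightarrow> 'x" where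
  "tail_map X n x = (\<lambda>i. X (n + i) x)"

definition tail_obs :: "(nat \<Rightarrow> 'e \<Rightarrow> 'x) \<Rightarrow> (nat \<Rightarrow> (nat \<Rightarrow> 'x) \<Rightarrow> real) \<Rightarrow> nat \<Rightarrow> 'e \<Rightarrow> real" where
  "tail_obs X g k x = g k (tail_map X k x)"

definition partial_sum :: "(nat \<Rightarrow> 'e \<Rightarrow> 'x) \<Rightarrow> (nat \<Rightarrow> (nat \<Rightarrow> 'x) \<Rightarrow> real) \<Rightarrow> nat \<Rightarrow> 'e \<Rightarrow> real" where
  "partial_sum X g n x = (\<Sum>k<n. tail_obs X g k x)"

text \<open>Powers with a positive exponent \<open>a\<close>, extended to the value \<open>\<infinity>\<close>.\<close>

definition epowr :: "ennreal \<Rightarrow> real \<Rightarrow> ennreal" where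
  "epowr x a = (if x = \<infinity> then \<infinity> else ennreal (enn2real x powr a))"

text \<open>
  The norm of \<open>L^p(M)\<close>, for \<open>1 \<le> p \<le> \<infinity>\<close> and measurable \<open>f\<close>; it takes the value \<open>\<infinity>\<close> outside \<open>L^p(M)\<close>.
\<close>

definition Lp_norm :: "'e measure \<Rightarrow> ennreal \<Rightarrow> ('e \<Rightarrow> 'b::real_normed_vector) \<Rightarrow> ennreal" where
  "Lp_norm M p f =
     (if p = \<infinity> then esssup M (\<lambda>x. ennreal (norm (f x)))
      else epowr (\<integral>\<^sup>+ x. ennreal (norm (f x) powr enn2real p) \<partial>M) (1 / enn2real p))"

text \<open>
  No norm axioms are imposed on the ``norm'' \<open>N\<close> on \<open>B\<close>, and \<open>B\<close> need not be a vector space.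
  Taking \<open>f = 1\<close> shows that \<open>N s \<ge> 0\<close> for \<open>s \<in> B\<close> as soon as some \<open>\<delta> n\<close> is positive.
  The essential supremum below is finite because \<open>f\<close> is bounded.
\<close>

definition decay_of_correlations ::
  "'e measure \<Rightarrow> (nat \<Rightarrow> 'x measure) \<Rightarrow> (nat \<Rightarrow> 'e \<Rightarrow> 'x) \<Rightarrow>
   ('e \<Rightarrow> real) set \<Rightarrow> (('e \<Rightarrow> real) \<Rightarrow> real) \<Rightarrow> (nat \<Rightarrow> real) \<Rightarrow> bool" where
  "decay_of_correlations \<mu> XX X B N \<delta> \<longleftrightarrow>
     \<delta> \<longlonglongrightarrow> 0 \<and>
     (\<forall>s\<in>B. integrable \<mu> s) \<and>
     (\<forall>n. \<forall>s\<in>B. \<forall>f :: (nat \<Rightarrow> 'x) \<Rightarrow> complex.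
        f \<in> borel_measurable (tail_space XX n) \<and> bounded (f ` space (tail_space XX n)) \<longrightarrow>
        cmod ((\<integral>x. of_real (s x) * f (tail_map X n x) \<partial>\<mu>)
              - of_real (\<integral>x. s x \<partial>\<mu>) * (\<integral>x. f (tail_map X n x) \<partial>\<mu>))
          \<le> N s * enn2real (Lp_norm \<mu> \<infinity> (\<lambda>x. f (tail_map X n x))) * \<delta> n)"

text \<open>The distribution of \<open>(Z - E Z) / sqrt (Var Z)\<close> when \<open>x\<close> is distributed according to \<open>M\<close>.\<close>

definition standardized_law :: "'e measure \<Rightarrow> ('e \<Rightarrow> real) \<Rightarrow> real measure" where
  "standardized_law M Z = distr M borel (\<lambda>x. (Z x - prob_space.expectation M Z) / sqrt (prob_space.variance M Z))"

text \<open>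
  The quantity \<open>\<M>_n\<close>. It is \<open>ennreal\<close>-valued because \<open>G j\<close> need not belong to \<open>L^{p2}\<close>.
\<close>

definition mean_bound ::
  "'e measure \<Rightarrow> (nat \<Rightarrow> 'e \<Rightarrow> real) \<Rightarrow> (nat \<Rightarrow> real) \<Rightarrow> (nat \<Rightarrow> real) \<Rightarrow> real \<Rightarrow> real \<Rightarrow> nat \<Rightarrow> ennreal" where
  "mean_bound \<mu> G \<delta> M p2 p3 n =
     (\<Sum>j<n. ennreal (M j * \<delta> j)
            + epowr (Lp_norm \<mu> (ennreal p2) (G j)) (1 + p2 / p3) * ennreal (M j powr (- (p2 / p3))))"

end

theory Submission
  imports Defs "HOL-Real_Asymp.Real_Asymp"
begin

text \<open>
  Truncation extends (DC) to the unbounded observables \<open>G k\<close> and \<open>G j * G k\<close>, because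
  the moments of order \<open>p > 3\<close> grow subexponentially while the mixing rate is exponential. Mixing
  between times \<open>j\<close> and \<open>k\<close> (for \<open>k\<close> large compared to \<open>j\<close>) and between \<open>r\<close> and
  time \<open>j\<close> (otherwise) bounds \<open>\<integral> G j G k d\<mu> - \<integral> G j G k d\<nu>\<close> by a summable function of
  \<open>max j k\<close>. In the same way \<open>\<Sum>k. \<bar>\<integral> G k d\<nu>\<bar>\<close> converges, so the means under \<open>\<nu>\<close> are bounded and
  the variances differ by a bounded amount. For the distributional statement, the first \<open>m\<close> terms
  are negligible after normalization and the remaining ones are almost independent of \<open>r\<close>, so
  the characteristic functions under \<open>\<mu>\<close> and \<open>\<nu>\<close> merge, and Levy's theorem applies.
\<close>

section \<open>Elementary real estimates and moments\<close>

text \<open>A one-exponent substitute for Hoelder's inequality: each factor is at most a power of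
  the maximum of 1 and the three bases, and above 1 the exponent may be raised to
  \<open>p\<close>.\<close>

lemma powr_prod_le_sum_powr:
  fixes x y z u v w p :: real
  assumes "0 \<le> x" "0 \<le> y" "0 \<le> z" "0 \<le> u" "0 \<le> v" "0 \<le> w" "u + v + w \<le> p"
  shows "x powr u * y powr v * z powr w \<le> 1 + x powr p + y powr p + z powr p"
proof -
  define m where "m = max 1 (max x (max y z))"
  have m: "1 \<le> m" "x \<le> m" "y \<le> m" "z \<le> m" by (auto simp: m_def)
  have "x powr u * y powr v * z powr w \<le> m powr u * m powr v * m powr w"
    using assms m by (intro mult_mono powr_mono2) auto
  also have "\<dots> = m powr (u + v + w)" by (simp add: powr_add)
  also have "\<dots> \<le> m powr p" using assms m by (intro powr_mono) auto
  also have "m = 1 \<or> m = x \<or> m = y \<or> m = z" by (auto simp: m_def max_def)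
  hence "m powr p \<le> 1 + x powr p + y powr p + z powr p"
    by (elim disjE) (auto simp: add_nonneg_nonneg add_increasing add_increasing2)
  finally show ?thesis .
qed

lemma powr_moment_of_Lp_norm_le:
  fixes f :: "'a \<Rightarrow> real"
  assumes [measurable]: "f \<in> borel_measurable M" and "0 < p" "0 \<le> c"
    and le: "Lp_norm M (ennreal p) f \<le> ennreal c"
  shows "integrable M (\<lambda>x. \<bar>f x\<bar> powr p)" "(\<integral>x. \<bar>f x\<bar> powr p \<partial>M) \<le> c powr p"
proof -
  define I where "I = (\<integral>\<^sup>+ x. ennreal (\<bar>f x\<bar> powr p) \<partial>M)"
  have L: "epowr I (1 / p) \<le> ennreal c"
    using le \<open>0 < p\<close> by (simp add: Lp_norm_def I_def)
  \<comment> \<open>\<open>epowr\<close> sends \<open>\<infinity>\<close> to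
    \<open>\<infinity>\<close>, so the finite bound \<open>c\<close> rules out an infinite
    moment.\<close>
  have "I \<noteq> \<infinity>" using L by (auto simp: epowr_def top_unique)
  then obtain i where i: "I = ennreal i" "0 \<le> i" by (cases I) auto
  have "i powr (1 / p) \<le> c" using L i \<open>0 \<le> c\<close> by (simp add: epowr_def)
  hence "(i powr (1 / p)) powr p \<le> c powr p" using \<open>0 < p\<close> by (intro powr_mono2) auto
  hence ic: "i \<le> c powr p" using \<open>0 < p\<close> i by (simp add: powr_powr)
  show int: "integrable M (\<lambda>x. \<bar>f x\<bar> powr p)"
    using i by (intro integrableI_bounded) (auto simp: I_def)
  have "ennreal (\<integral>x. \<bar>f x\<bar> powr p \<partial>M) = I"
    unfolding I_def using int by (intro nn_integral_eq_integral[symmetric]) auto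
  hence "(\<integral>x. \<bar>f x\<bar> powr p \<partial>M) = i" using i
    by (metis integral_nonneg_AE AE_I2 ennreal_inj powr_ge_zero)
  thus "(\<integral>x. \<bar>f x\<bar> powr p \<partial>M) \<le> c powr p" using ic by simp
qed

text \<open>As \<open>\<beta> < 1\<close>, half of the exponential decay eventually absorbs the
  subexponential growth; the other half beats the linear factor.\<close>

lemma summable_linear_times_subexponential:
  fixes c D \<beta> :: real
  assumes "0 < c" "0 \<le> D" "\<beta> < 1"
  shows "summable (\<lambda>k::nat. (real k + 1) * (exp (- c * real k) * exp (D * real k powr \<beta>)))"
proof (rule summable_comparison_test_ev)
  have lim: "((\<lambda>k::nat. D * real k powr (\<beta> - 1)) \<longlongrightarrow> 0) sequentially"
    using assms by (intro tendsto_mult_right_zero tendsto_neg_powr filterlim_real_sequentially) auto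
  have "\<forall>\<^sub>F k::nat in sequentially. D * real k powr (\<beta> - 1) < c / 2"
    using order_tendstoD(2)[OF lim, of "c / 2"] assms by auto
  moreover have "\<forall>\<^sub>F k::nat in sequentially. (real k + 1) * exp (- (c / 2) * real k) \<le> 1 / real k ^ 2"
    using assms by real_asymp
  ultimately show "\<forall>\<^sub>F k::nat in sequentially.
      norm ((real k + 1) * (exp (- c * real k) * exp (D * real k powr \<beta>))) \<le> 1 / real k ^ 2"
    using eventually_gt_at_top[of 0]
  proof eventually_elim
    case (elim k)
    have "D * real k powr \<beta> = D * real k powr (\<beta> - 1) * real k"
      using elim by (simp add: powr_diff)
    also have "\<dots> \<le> c / 2 * real k" using elim by (intro mult_right_mono) auto
    finally have "- c * real k + D * real k powr \<beta> \<le> - (c / 2) * real k" by simp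
    hence "(real k + 1) * exp (- c * real k + D * real k powr \<beta>) \<le> (real k + 1) * exp (- (c / 2) * real k)"
      by (intro mult_left_mono) auto
    hence "(real k + 1) * (exp (- c * real k) * exp (D * real k powr \<beta>)) \<le> (real k + 1) * exp (- (c / 2) * real k)"
      by (simp only: exp_add)
    also have "\<dots> \<le> 1 / real k ^ 2" by (rule elim)
    finally show ?case by (subst real_norm_def, subst abs_of_nonneg) auto
  qed
  show "summable (\<lambda>k::nat. 1 / real k ^ 2)"
    using inverse_power_summable[of 2, where 'a=real] by (simp add: inverse_eq_divide)
qed

text \<open>Counting: exactly \<open>2 k + 1\<close> pairs of indices have maximum \<open>k\<close>.
  A bound in terms of the larger index thus reduces a double sum to a single series.\<close>

lemma sum_max_square:
  fixes u :: "nat \<Rightarrow> real"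
  shows "(\<Sum>j<n. \<Sum>k<n. u (max j k)) = (\<Sum>k<n. (2 * real k + 1) * u k)"
proof (induction n)
  case (Suc n)
  have "(\<Sum>k<n. u (max n k)) = real n * u n" "(\<Sum>j<n. u (max j n)) = real n * u n"
    by (simp_all add: max_def not_le)
  thus ?case using Suc by (simp add: sum.distrib algebra_simps)
qed simp

section \<open>Characteristic functions, weak convergence and normalizing constants\<close>

lemma (in prob_space) expectation_iexp_diff_le:
  fixes Z W :: "'a \<Rightarrow> real"
  assumes [measurable]: "Z \<in> borel_measurable M" "W \<in> borel_measurable M"
    and "integrable M (\<lambda>x. \<bar>Z x - W x\<bar>)"
  shows "cmod ((\<integral>x. iexp (Z x) \<partial>M) - (\<integral>x. iexp (W x) \<partial>M)) \<le> expectation (\<lambda>x. \<bar>Z x - W x\<bar>)"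
proof -
  have int: "integrable M (\<lambda>x. iexp (Y x))" if [measurable]: "Y \<in> borel_measurable M" for Y :: "'a \<Rightarrow> real"
    by (rule integrable_const_bound[where B=1]) auto
  have 1: "cmod (iexp z - iexp w) \<le> \<bar>z - w\<bar>" for z w :: real
  proof -
    have "iexp z - iexp w = iexp w * (iexp (z - w) - 1)"
      by (simp add: right_diff_distrib exp_diff)
    \<comment> \<open>At order 0 the Taylor remainder bound reads
      \<open>cmod (iexp x - 1) \<le> \<bar>x\<bar>\<close>.\<close>
    thus ?thesis using iexp_approx1[of "z - w" 0] by (simp add: norm_mult)
  qed
  have "cmod ((\<integral>x. iexp (Z x) \<partial>M) - (\<integral>x. iexp (W x) \<partial>M)) = cmod (\<integral>x. iexp (Z x) - iexp (W x) \<partial>M)"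
    using int by (simp add: Bochner_Integration.integral_diff)
  also have "\<dots> \<le> (\<integral>x. cmod (iexp (Z x) - iexp (W x)) \<partial>M)" by (rule integral_norm_bound)
  also have "\<dots> \<le> expectation (\<lambda>x. \<bar>Z x - W x\<bar>)"
    using assms int 1 by (intro integral_mono integrable_norm) auto
  finally show ?thesis .
qed

text \<open>Levy's continuity theorem, used in both of its directions: the characteristic functions
  of one sequence converge to \<open>char L\<close> as soon as those of the other do.\<close>

lemma weak_conv_m_iff_of_char_diff_tendsto_0:
  assumes "\<And>n. real_distribution (P n)" "\<And>n. real_distribution (Q n)" "real_distribution L"
    and lim: "\<And>t. (\<lambda>n. char (P n) t - char (Q n) t) \<longlonglongrightarrow> 0"
  shows "weak_conv_m P L \<longleftrightarrow> weak_conv_m Q L"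
proof -
  have imp: "weak_conv_m Q L" if "weak_conv_m P L" "\<And>n. real_distribution (P n)"
     "\<And>n. real_distribution (Q n)" "\<And>t. (\<lambda>n. char (P n) t - char (Q n) t) \<longlonglongrightarrow> 0" for P Q
  proof (rule levy_continuity[OF that(3) assms(3)])
    fix t
    have "(\<lambda>n. char (P n) t) \<longlonglongrightarrow> char L t" by (rule levy_continuity1[OF that(2) assms(3) that(1)])
    from tendsto_diff[OF this that(4)[of t]] show "(\<lambda>n. char (Q n) t) \<longlonglongrightarrow> char L t" by simp
  qed
  have "(\<lambda>n. char (Q n) t - char (P n) t) \<longlonglongrightarrow> 0" for t
    using tendsto_minus[OF lim[of t]] by simp
  from imp[OF _ assms(2,1) this] imp[OF _ assms(1,2) lim] show ?thesis by (rule iffI[rotated])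
qed

lemma char_standardized_law:
  assumes [measurable]: "Z \<in> borel_measurable M"
  shows "char (standardized_law M Z) t
    = (\<integral>x. iexp (t * ((Z x - prob_space.expectation M Z) / sqrt (prob_space.variance M Z))) \<partial>M)"
  unfolding char_def standardized_law_def by (subst integral_distr) auto

lemma (in prob_space) real_distribution_standardized_law:
  assumes [measurable]: "Z \<in> borel_measurable M"
  shows "real_distribution (standardized_law M Z)"
  unfolding standardized_law_def by (rule real_distribution_distr) measurable

text \<open>A bounded difference is negligible against \<open>V n\<close>, which tends to infinity,
  so \<open>W n / V n = 1 + (W n - V n) / V n\<close> tends to 1.\<close>

lemma sqrt_ratio_tendsto_1:
  fixes V W :: "nat \<Rightarrow> real"
  assumes lim: "filterlim (\<lambda>n. sqrt (V n)) at_top sequentially" and C: "\<And>n. \<bar>V n - W n\<bar> \<le> C"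
  shows "(\<lambda>n. sqrt (V n) / sqrt (W n)) \<longlonglongrightarrow> 1"
proof -
  have pos: "\<forall>\<^sub>F n in sequentially. 1 \<le> sqrt (V n)"
    by (rule lim[unfolded filterlim_at_top, rule_format])
  have "filterlim (\<lambda>n. sqrt (V n) * sqrt (V n)) at_top sequentially"
    by (rule filterlim_at_top_mult_at_top[OF lim lim])
  \<comment> \<open>\<open>sqrt\<close> is odd on the reals, so its square is \<open>V n\<close>
    only for \<open>0 \<le> V n\<close>, which \<open>1 \<le> sqrt (V n)\<close> ensures.\<close>
  moreover have "\<forall>\<^sub>F n in sequentially. sqrt (V n) * sqrt (V n) = V n"
    using pos
  proof eventually_elim
    case (elim n)
    hence "0 \<le> V n" using real_sqrt_ge_1_iff[of "V n"] by linarith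
    thus ?case by simp
  qed
  ultimately have V: "filterlim V at_top sequentially"
    by (rule filterlim_cong[THEN iffD1, OF refl refl, rotated])
  have q0: "(\<lambda>n. (W n - V n) / V n) \<longlonglongrightarrow> 0"
  proof (rule Lim_null_comparison)
    show "(\<lambda>n. C / V n) \<longlonglongrightarrow> 0" by (rule real_tendsto_divide_at_top[OF tendsto_const V])
    show "\<forall>\<^sub>F n in sequentially. norm ((W n - V n) / V n) \<le> C / V n"
      using filterlim_at_top_dense[THEN iffD1, OF V, rule_format, of 0]
      by eventually_elim (use C in \<open>auto simp: abs_minus_commute intro!: divide_right_mono\<close>)
  qed
  have "(\<lambda>n. 1 / sqrt (1 + (W n - V n) / V n)) \<longlonglongrightarrow> 1 / sqrt (1 + 0)"
    by (intro tendsto_intros q0) auto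
  moreover have "\<forall>\<^sub>F n in sequentially. 1 / sqrt (1 + (W n - V n) / V n) = sqrt (V n) / sqrt (W n)"
    using filterlim_at_top_dense[THEN iffD1, OF V, rule_format, of 0]
    by eventually_elim (simp add: diff_divide_distrib real_sqrt_divide)
  ultimately show ?thesis by (simp add: tendsto_cong)
qed

section \<open>Tail maps and decay of correlations\<close>

lemma tail_map_measurable:
  assumes "\<And>j. X j \<in> measurable M (XX j)"
  shows "tail_map X n \<in> measurable M (tail_space XX n)"
  unfolding tail_map_def tail_space_def by (rule measurable_PiM_single') (use assms measurable_space[OF assms] in auto)

text \<open>Makes an observable of time \<open>k\<close> a function on the tail space of an earlier
  time \<open>j\<close>: coordinate \<open>i\<close> of the later tail is coordinate
  \<open>k - j + i\<close> of the earlier one.\<close>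

lemma tail_shift_measurable:
  assumes "j \<le> k"
  shows "(\<lambda>y i. y (k - j + i)) \<in> measurable (tail_space XX j) (tail_space XX k)"
proof -
  have *: "XX (k + i) = XX (j + (k - j + i))" for i using assms by simp
  have comp: "(\<lambda>y. y (k - j + i)) \<in> measurable (PiM UNIV (\<lambda>i. XX (j + i))) (XX (k + i))" for i
    unfolding * by (rule measurable_component_singleton) simp
  show ?thesis
    unfolding tail_space_def
    by (rule measurable_PiM_single') (use comp measurable_space[OF comp] in auto)
qed

locale decaying_process = prob_space \<mu> for \<mu> :: "'e measure" +
  fixes XX :: "nat \<Rightarrow> 'x measure" and X :: "nat \<Rightarrow> 'e \<Rightarrow> 'x"
    and B :: "('e \<Rightarrow> real) set" and N :: "('e \<Rightarrow> real) \<Rightarrow> real" and \<delta>s :: "nat \<Rightarrow> real"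
  assumes X_measurable: "\<And>j. X j \<in> measurable \<mu> (XX j)"
    and decay: "decay_of_correlations \<mu> XX X B N \<delta>s"
    and decay_rate_nonneg: "\<And>n. 0 \<le> \<delta>s n"
begin

lemma tail_map_meas [measurable]: "tail_map X n \<in> measurable \<mu> (tail_space XX n)"
  by (rule tail_map_measurable) (rule X_measurable)

lemma integrable_B: "s \<in> B \<Longrightarrow> integrable \<mu> s"
  using decay by (auto simp: decay_of_correlations_def)

text \<open>(DC) with the norm and the essential supremum relaxed to upper bounds, which
  \<open>decay_rate_nonneg\<close> permits. \<open>K\<close> is separate from \<open>N s\<close>
  because no sign of \<open>N s\<close> is assumed here.\<close>

lemma covariance_bound:
  fixes f :: "(nat \<Rightarrow> 'x) \<Rightarrow> complex"
  assumes s: "s \<in> B" and K: "N s \<le> K" "0 \<le> K"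
    and f [measurable]: "f \<in> borel_measurable (tail_space XX n)" and M: "\<And>y. cmod (f y) \<le> M"
  shows "cmod ((\<integral>x. of_real (s x) * f (tail_map X n x) \<partial>\<mu>)
           - of_real (\<integral>x. s x \<partial>\<mu>) * (\<integral>x. f (tail_map X n x) \<partial>\<mu>)) \<le> K * M * \<delta>s n"
proof -
  have M0: "0 \<le> M" using order_trans[OF norm_ge_zero M] .
  let ?E = "Lp_norm \<mu> \<infinity> (\<lambda>x. f (tail_map X n x))"
  have "?E \<le> ennreal M"
    unfolding Lp_norm_def using M by (auto intro!: esssup_I ennreal_leI)
  hence E: "enn2real ?E \<le> M" using M0 by (simp add: enn2real_leI)
  have "bounded (f ` space (tail_space XX n))" using M by (auto simp: bounded_iff)
  with decay s f have "cmod ((\<integral>x. of_real (s x) * f (tail_map X n x) \<partial>\<mu>)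
           - of_real (\<integral>x. s x \<partial>\<mu>) * (\<integral>x. f (tail_map X n x) \<partial>\<mu>)) \<le> N s * enn2real ?E * \<delta>s n"
    unfolding decay_of_correlations_def by blast
  also have "\<dots> \<le> K * enn2real ?E * \<delta>s n"
    using K decay_rate_nonneg by (intro mult_right_mono) auto
  also have "\<dots> \<le> K * M * \<delta>s n"
    using K E decay_rate_nonneg by (intro mult_right_mono mult_left_mono) auto
  finally show ?thesis .
qed

text \<open>Truncation at height \<open>M\<close>: (DC) treats the bounded part, and the part cut
  off is paid for by the moment of order \<open>1 + \<epsilon>\<close>, once weighted by
  \<open>s\<close> and once in the product of means. \<open>M\<close> stays free so that the two
  errors can be balanced later.\<close>

lemma covariance_bound_unbounded:
  fixes h :: "(nat \<Rightarrow> 'x) \<Rightarrow> real" and \<epsilon> M :: real and n :: nat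
  defines "H \<equiv> \<lambda>x. h (tail_map X n x)"
  assumes s: "s \<in> B" and K: "N s \<le> K" "0 \<le> K"
    and h [measurable]: "h \<in> borel_measurable (tail_space XX n)"
    and M: "0 < M" and \<epsilon>: "0 \<le> \<epsilon>"
    and sH: "integrable \<mu> (\<lambda>x. s x * H x)" and iH: "integrable \<mu> H"
    and sHe: "integrable \<mu> (\<lambda>x. \<bar>s x\<bar> * \<bar>H x\<bar> powr (1 + \<epsilon>))"
    and He: "integrable \<mu> (\<lambda>x. \<bar>H x\<bar> powr (1 + \<epsilon>))"
  shows "\<bar>(\<integral>x. s x * H x \<partial>\<mu>) - (\<integral>x. s x \<partial>\<mu>) * (\<integral>x. H x \<partial>\<mu>)\<bar>
     \<le> K * M * \<delta>s n + M powr (- \<epsilon>) * ((\<integral>x. \<bar>s x\<bar> * \<bar>H x\<bar> powr (1 + \<epsilon>) \<partial>\<mu>)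
          + \<bar>\<integral>x. s x \<partial>\<mu>\<bar> * (\<integral>x. \<bar>H x\<bar> powr (1 + \<epsilon>) \<partial>\<mu>))"
proof -
  define t where "t = (\<lambda>y. if \<bar>h y\<bar> \<le> M then h y else 0)"
  define T where "T = (\<lambda>x. t (tail_map X n x))"
  have [measurable]: "t \<in> borel_measurable (tail_space XX n)" unfolding t_def by measurable
  have [measurable]: "T \<in> borel_measurable \<mu>" "H \<in> borel_measurable \<mu>" "s \<in> borel_measurable \<mu>"
    using integrable_B[OF s] by (auto simp: T_def H_def)
  have TM: "\<bar>T x\<bar> \<le> M" for x using M by (auto simp: T_def t_def)
  have TH: "\<bar>T x\<bar> \<le> \<bar>H x\<bar>" for x by (auto simp: T_def t_def H_def)
  \<comment> \<open>Where \<open>H\<close> is cut off, \<open>M < \<bar>H x\<bar>\<close>, so an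
    extra factor \<open>\<bar>H x\<bar> powr \<epsilon>\<close> is gained at the price
    \<open>M powr (- \<epsilon>)\<close>.\<close>
  have tail: "\<bar>H x - T x\<bar> \<le> M powr (- \<epsilon>) * \<bar>H x\<bar> powr (1 + \<epsilon>)" for x
  proof (cases "\<bar>H x\<bar> \<le> M")
    case True thus ?thesis by (simp add: T_def t_def H_def)
  next
    case False
    have "\<bar>H x\<bar> = M powr (- \<epsilon>) * (\<bar>H x\<bar> * M powr \<epsilon>)" using M by (simp add: powr_minus)
    also have "\<dots> \<le> M powr (- \<epsilon>) * (\<bar>H x\<bar> * \<bar>H x\<bar> powr \<epsilon>)"
      using False M \<epsilon> by (intro mult_left_mono powr_mono2) auto
    also have "\<bar>H x\<bar> * \<bar>H x\<bar> powr \<epsilon> = \<bar>H x\<bar> powr (1 + \<epsilon>)" using False M by (simp add: powr_add)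
    finally show ?thesis using False by (simp add: T_def t_def H_def)
  qed
  have iT: "integrable \<mu> T" by (rule Bochner_Integration.integrable_bound[OF iH]) (use TH in auto)
  have sT: "integrable \<mu> (\<lambda>x. s x * T x)"
    by (rule Bochner_Integration.integrable_bound[OF sH]) (use TH in \<open>auto simp: abs_mult mult_left_mono\<close>)
  have "cmod ((\<integral>x. of_real (s x) * of_real (t (tail_map X n x)) \<partial>\<mu>)
           - of_real (\<integral>x. s x \<partial>\<mu>) * (\<integral>x. of_real (t (tail_map X n x)) \<partial>\<mu>)) \<le> K * M * \<delta>s n"
    using M by (intro covariance_bound[OF s K]) (auto simp: t_def)
  hence main: "\<bar>(\<integral>x. s x * T x \<partial>\<mu>) - (\<integral>x. s x \<partial>\<mu>) * (\<integral>x. T x \<partial>\<mu>)\<bar> \<le> K * M * \<delta>s n"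
    by (simp add: T_def flip: of_real_mult of_real_diff)
  have "\<bar>\<integral>x. s x * (H x - T x) \<partial>\<mu>\<bar> \<le> (\<integral>x. \<bar>s x * (H x - T x)\<bar> \<partial>\<mu>)"
    by (rule integral_abs_bound)
  also have "\<dots> \<le> (\<integral>x. M powr (- \<epsilon>) * (\<bar>s x\<bar> * \<bar>H x\<bar> powr (1 + \<epsilon>)) \<partial>\<mu>)"
  proof (rule integral_mono)
    show "integrable \<mu> (\<lambda>x. \<bar>s x * (H x - T x)\<bar>)"
      using sH sT by (simp add: right_diff_distrib)
    show "integrable \<mu> (\<lambda>x. M powr (- \<epsilon>) * (\<bar>s x\<bar> * \<bar>H x\<bar> powr (1 + \<epsilon>)))" using sHe by simp
    show "\<bar>s x * (H x - T x)\<bar> \<le> M powr (- \<epsilon>) * (\<bar>s x\<bar> * \<bar>H x\<bar> powr (1 + \<epsilon>))" for x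
      using mult_left_mono[OF tail[of x], of "\<bar>s x\<bar>"] by (simp add: abs_mult mult_ac)
  qed
  finally have e1: "\<bar>(\<integral>x. s x * H x \<partial>\<mu>) - (\<integral>x. s x * T x \<partial>\<mu>)\<bar>
      \<le> M powr (- \<epsilon>) * (\<integral>x. \<bar>s x\<bar> * \<bar>H x\<bar> powr (1 + \<epsilon>) \<partial>\<mu>)"
    using sH sT by (simp add: right_diff_distrib)
  have "\<bar>\<integral>x. H x - T x \<partial>\<mu>\<bar> \<le> (\<integral>x. \<bar>H x - T x\<bar> \<partial>\<mu>)" by (rule integral_abs_bound)
  also have "\<dots> \<le> (\<integral>x. M powr (- \<epsilon>) * \<bar>H x\<bar> powr (1 + \<epsilon>) \<partial>\<mu>)"
    using iH iT He tail by (intro integral_mono) auto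
  finally have "\<bar>(\<integral>x. H x \<partial>\<mu>) - (\<integral>x. T x \<partial>\<mu>)\<bar> \<le> M powr (- \<epsilon>) * (\<integral>x. \<bar>H x\<bar> powr (1 + \<epsilon>) \<partial>\<mu>)"
    using iH iT by simp
  hence "\<bar>\<integral>x. s x \<partial>\<mu>\<bar> * \<bar>(\<integral>x. H x \<partial>\<mu>) - (\<integral>x. T x \<partial>\<mu>)\<bar>
     \<le> \<bar>\<integral>x. s x \<partial>\<mu>\<bar> * (M powr (- \<epsilon>) * (\<integral>x. \<bar>H x\<bar> powr (1 + \<epsilon>) \<partial>\<mu>))"
    by (intro mult_left_mono) auto
  moreover have "(\<integral>x. s x \<partial>\<mu>) * (\<integral>x. H x \<partial>\<mu>) - (\<integral>x. s x \<partial>\<mu>) * (\<integral>x. T x \<partial>\<mu>)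
      = (\<integral>x. s x \<partial>\<mu>) * ((\<integral>x. H x \<partial>\<mu>) - (\<integral>x. T x \<partial>\<mu>))"
    by (rule right_diff_distrib[symmetric])
  ultimately have e2: "\<bar>(\<integral>x. s x \<partial>\<mu>) * (\<integral>x. H x \<partial>\<mu>) - (\<integral>x. s x \<partial>\<mu>) * (\<integral>x. T x \<partial>\<mu>)\<bar>
     \<le> M powr (- \<epsilon>) * (\<bar>\<integral>x. s x \<partial>\<mu>\<bar> * (\<integral>x. \<bar>H x\<bar> powr (1 + \<epsilon>) \<partial>\<mu>))"
    by (simp only: abs_mult mult.left_commute)
  from main e1 e2 show ?thesis unfolding distrib_left by linarith
qed

end

section \<open>Exponential mixing with subexponential moments: setting and constants\<close>

locale exp_decaying_sums = decaying_process \<mu> XX X B N "\<lambda>k. C1 * \<delta> ^ k"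
  for \<mu> :: "'e measure" and XX :: "nat \<Rightarrow> 'x measure" and X B N and C1 \<delta> :: real +
  fixes g :: "nat \<Rightarrow> (nat \<Rightarrow> 'x) \<Rightarrow> real" and r :: "'e \<Rightarrow> real" and a b c0 C0 \<beta> p :: real
  assumes g_measurable [measurable]: "\<And>j. g j \<in> borel_measurable (tail_space XX j)"
    and r_B: "r \<in> B" and r_nonneg: "AE x in \<mu>. 0 \<le> r x" and r_int: "(\<integral>x. r x \<partial>\<mu>) = 1"
    and centered: "\<And>k. (\<integral>x. tail_obs X g k x \<partial>\<mu>) = 0"
    and C1: "0 < C1" and \<delta>: "0 < \<delta>" "\<delta> < 1"
    and G_B: "\<And>k. tail_obs X g k \<in> B" and rG_B: "\<And>k. (\<lambda>x. r x * tail_obs X g k x) \<in> B"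
    and a: "0 < a" and b: "0 < b"
    and N_bound: "\<And>k. N (tail_obs X g k) \<le> b * \<delta> powr (- (a * real k))"
      "\<And>k. N (\<lambda>x. r x * tail_obs X g k x) \<le> b * \<delta> powr (- (a * real k))"
    and c0: "0 < c0" and C0: "0 < C0" and \<beta>: "0 < \<beta>" "\<beta> < 1" and p: "3 < p"
    and G_Lp: "\<And>k. Lp_norm \<mu> (ennreal p) (tail_obs X g k) \<le> ennreal (C0 * exp (c0 * real k powr \<beta>))"
    and r_Lp: "Lp_norm \<mu> (ennreal p) r < \<infinity>"
begin

abbreviation "G \<equiv> tail_obs X g"
abbreviation "S \<equiv> partial_sum X g"

definition \<nu> :: "'e measure" where "\<nu> = density \<mu> (\<lambda>x. ennreal (r x))"

text \<open>Solves \<open>1 + 2 * (1 + \<epsilon>) = p\<close>, the degree of \<open>r\<close> times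
  the power \<open>1 + \<epsilon>\<close> of \<open>G j * G k\<close>; it is positive because
  \<open>p > 3\<close>.\<close>

definition \<epsilon> :: real where "\<epsilon> = (p - 3) / 2"

text \<open>Common envelope of all mixed moments in use. The 3 collects the 1 of
  \<open>powr_prod_le_sum_powr\<close> and two factors that may be replaced by 1;
  \<open>2 * C0 powr p\<close> accounts for \<open>G j\<close> and \<open>G k\<close>.\<close>

definition env :: "nat \<Rightarrow> real" where
  "env k = (3 + (\<integral>x. \<bar>r x\<bar> powr p \<partial>\<mu>) + 2 * C0 powr p) * exp (p * c0 * real k powr \<beta>)"

text \<open>Truncating at level \<open>\<delta> powr - (k / 4)\<close> if \<open>a j \<le> k / 2\<close> and at \<open>\<delta> powr - (j / 2)\<close> otherwise
  leaves errors \<open>\<delta> powr (k / 4)\<close>, \<open>\<delta> powr (\<epsilon> k / 4)\<close>, \<open>\<delta> powr (k / (4 a))\<close> and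
  \<open>\<delta> powr (\<epsilon> k / (4 a))\<close> at worst; \<open>\<delta> powr (\<eta> k)\<close> dominates all four.\<close>

definition \<eta> :: real where "\<eta> = min 1 \<epsilon> * min (1 / 4) (1 / (4 * a))"

text \<open>Sum of three mixing errors: two between times \<open>j\<close> and \<open>k\<close>,
  under \<open>\<mu>\<close> and weighted by \<open>r\<close>, and one between \<open>r\<close> and
  the earlier time. The square of \<open>env\<close> bounds a mean times a moment.\<close>

definition rate :: "nat \<Rightarrow> real" where
  "rate k = (2 * (b * C1 + 2) + (\<bar>N r\<bar> * C1 + 2)) * (\<delta> powr (\<eta> * real k) * (env k)\<^sup>2)"

text \<open>The weight anticipates \<open>sum_max_square\<close>.\<close>

definition total_rate :: real where "total_rate = (\<Sum>k. (2 * real k + 1) * rate k)"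

section \<open>Measurability, moments and integrability\<close>

lemma \<epsilon>_pos: "0 < \<epsilon>" using p by (simp add: \<epsilon>_def)

lemma r_measurable [measurable]: "r \<in> borel_measurable \<mu>"
  using integrable_B[OF r_B] by simp

lemma G_measurable [measurable]: "G k \<in> borel_measurable \<mu>"
  unfolding tail_obs_def[abs_def] by measurable

lemma G_of_tail: "j \<le> k \<Longrightarrow> G k x = g k (\<lambda>i. tail_map X j x (k - j + i))"
  by (simp add: tail_obs_def tail_map_def)

lemma G_of_tail_measurable [measurable]:
  "j \<le> k \<Longrightarrow> (\<lambda>y. g k (\<lambda>i. y (k - j + i))) \<in> borel_measurable (tail_space XX j)"
  using measurable_compose[OF tail_shift_measurable g_measurable] .

lemma S_measurable [measurable]: "S n \<in> borel_measurable \<mu>"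
  unfolding partial_sum_def[abs_def] by measurable

lemma env_ge_1: "1 \<le> env k"
proof -
  have "0 \<le> (\<integral>x. \<bar>r x\<bar> powr p \<partial>\<mu>)" by simp
  moreover have "1 \<le> exp (p * c0 * real k powr \<beta>)" using p c0 by simp
  ultimately show ?thesis unfolding env_def
    using mult_mono[of 1 "3 + (\<integral>x. \<bar>r x\<bar> powr p \<partial>\<mu>) + 2 * C0 powr p" 1] by force
qed

lemma r_powr: "integrable \<mu> (\<lambda>x. \<bar>r x\<bar> powr p)"
proof -
  obtain c where "0 \<le> c" "Lp_norm \<mu> (ennreal p) r = ennreal c"
    using r_Lp by (cases "Lp_norm \<mu> (ennreal p) r") auto
  thus ?thesis using p by (intro powr_moment_of_Lp_norm_le(1)[of _ _ _ c]) auto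
qed

lemma G_powr:
  "integrable \<mu> (\<lambda>x. \<bar>G k x\<bar> powr p)"
  "(\<integral>x. \<bar>G k x\<bar> powr p \<partial>\<mu>) \<le> C0 powr p * exp (p * c0 * real k powr \<beta>)"
proof -
  have "(C0 * exp (c0 * real k powr \<beta>)) powr p = C0 powr p * exp (p * c0 * real k powr \<beta>)"
    using C0 by (simp add: powr_mult exp_powr_real mult_ac)
  with powr_moment_of_Lp_norm_le[OF G_measurable _ _ G_Lp[of k]] p C0
  show "integrable \<mu> (\<lambda>x. \<bar>G k x\<bar> powr p)"
    "(\<integral>x. \<bar>G k x\<bar> powr p \<partial>\<mu>) \<le> C0 powr p * exp (p * c0 * real k powr \<beta>)" by auto
qed

text \<open>The flags \<open>cr\<close> and \<open>cj\<close> switch off the factors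
  \<open>r\<close> and \<open>G j\<close>, so that one statement serves every integrand. The
  integrand is dominated pointwise by a sum of \<open>p\<close>-th powers, and
  \<open>j \<le> k\<close> lets the growth at \<open>j\<close> be replaced by that at
  \<open>k\<close>.\<close>

lemma moment:
  fixes j k :: nat and cr cj :: bool and v w :: real
  assumes "j \<le> k" "0 \<le> v" "0 \<le> w" "1 + v + w \<le> p"
  defines "F \<equiv> \<lambda>x. (if cr then \<bar>r x\<bar> else 1) * (if cj then \<bar>G j x\<bar> else 1) powr v * \<bar>G k x\<bar> powr w"
  shows "integrable \<mu> F" "(\<integral>x. F x \<partial>\<mu>) \<le> env k"
proof -
  define D where "D x = 3 + \<bar>r x\<bar> powr p + \<bar>G j x\<bar> powr p + \<bar>G k x\<bar> powr p" for x
  have F0: "0 \<le> F x" for x by (simp add: F_def)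
  have FD: "F x \<le> D x" for x
  proof -
    let ?x = "if cr then \<bar>r x\<bar> else 1" and ?y = "if cj then \<bar>G j x\<bar> else 1"
    have "F x = ?x powr 1 * ?y powr v * \<bar>G k x\<bar> powr w" by (simp add: F_def)
    also have "\<dots> \<le> 1 + ?x powr p + ?y powr p + \<bar>G k x\<bar> powr p"
      using assms by (intro powr_prod_le_sum_powr) auto
    also have "\<dots> \<le> D x" by (auto simp: D_def)
    finally show ?thesis .
  qed
  have iD: "integrable \<mu> D" unfolding D_def using r_powr G_powr by simp
  have [measurable]: "F \<in> borel_measurable \<mu>" unfolding F_def by measurable
  show iF: "integrable \<mu> F"
    by (rule Bochner_Integration.integrable_bound[OF iD]) (use F0 FD in \<open>auto simp: abs_le_iff intro!: AE_I2 order_trans[OF FD abs_ge_self]\<close>)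
  have mono: "exp (p * c0 * real j powr \<beta>) \<le> exp (p * c0 * real k powr \<beta>)"
    using assms \<beta> p c0 by (auto intro!: mult_left_mono powr_mono2)
  have e1: "1 \<le> exp (p * c0 * real k powr \<beta>)" using p c0 by simp
  have "(\<integral>x. F x \<partial>\<mu>) \<le> (\<integral>x. D x \<partial>\<mu>)" using iF iD FD by (intro integral_mono) auto
  also have "\<dots> = 3 + (\<integral>x. \<bar>r x\<bar> powr p \<partial>\<mu>) + (\<integral>x. \<bar>G j x\<bar> powr p \<partial>\<mu>) + (\<integral>x. \<bar>G k x\<bar> powr p \<partial>\<mu>)"
    unfolding D_def using r_powr G_powr by (simp add: prob_space)
  \<comment> \<open>Terms without growth are multiplied by the exponential, which is at least 1, to
    make it a common factor.\<close>
  also have "\<dots> \<le> 3 * exp (p * c0 * real k powr \<beta>)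
      + (\<integral>x. \<bar>r x\<bar> powr p \<partial>\<mu>) * exp (p * c0 * real k powr \<beta>)
      + C0 powr p * exp (p * c0 * real k powr \<beta>) + C0 powr p * exp (p * c0 * real k powr \<beta>)"
  proof (intro add_mono)
    show "(\<integral>x. \<bar>r x\<bar> powr p \<partial>\<mu>) \<le> (\<integral>x. \<bar>r x\<bar> powr p \<partial>\<mu>) * exp (p * c0 * real k powr \<beta>)"
      using mult_left_mono[OF e1, of "\<integral>x. \<bar>r x\<bar> powr p \<partial>\<mu>"] by simp
    show "(\<integral>x. \<bar>G j x\<bar> powr p \<partial>\<mu>) \<le> C0 powr p * exp (p * c0 * real k powr \<beta>)"
      using G_powr(2)[of j] mult_left_mono[OF mono, of "C0 powr p"] by simp
  qed (use e1 G_powr in auto)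
  also have "\<dots> = env k" by (simp add: env_def algebra_simps)
  finally show "(\<integral>x. F x \<partial>\<mu>) \<le> env k" .
qed

text \<open>Degrees of the three kinds of integrand: \<open>r * G j * G k\<close>;
  \<open>r * G j\<close> against the power \<open>1 + \<epsilon>\<close> of \<open>G k\<close>;
  \<open>r\<close> against that power of \<open>G j * G k\<close>.\<close>

lemma \<epsilon>_exponents: "1 + 1 + 1 \<le> p" "1 + 1 + (1 + \<epsilon>) \<le> p" "1 + (1 + \<epsilon>) + (1 + \<epsilon>) \<le> p"
  using p by (auto simp: \<epsilon>_def field_simps)

lemma integrable_products:
  "integrable \<mu> (G k)" "integrable \<mu> (\<lambda>x. r x * G k x)"
  "integrable \<mu> (\<lambda>x. G j x * G k x)" "integrable \<mu> (\<lambda>x. r x * (G j x * G k x))"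
proof -
  show "integrable \<mu> (G k)" "integrable \<mu> (\<lambda>x. r x * G k x)"
    using integrable_B[OF G_B] integrable_B[OF rG_B] by auto
  have sym: "integrable \<mu> (\<lambda>x. G j x * G k x)" "integrable \<mu> (\<lambda>x. r x * (G j x * G k x))" if "j \<le> k" for j k
  proof -
    have "integrable \<mu> (\<lambda>x. \<bar>G j x * G k x\<bar>)" "integrable \<mu> (\<lambda>x. \<bar>r x * (G j x * G k x)\<bar>)"
      using moment(1)[OF that, of 1 1 False True] moment(1)[OF that, of 1 1 True True] \<epsilon>_exponents
      by (auto simp: abs_mult mult.assoc)
    thus "integrable \<mu> (\<lambda>x. G j x * G k x)" "integrable \<mu> (\<lambda>x. r x * (G j x * G k x))"
      by (simp_all add: integrable_abs_iff)
  qed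
  show "integrable \<mu> (\<lambda>x. G j x * G k x)" "integrable \<mu> (\<lambda>x. r x * (G j x * G k x))"
    using sym[of j k] sym[of k j] by (cases "j \<le> k"; simp add: mult.commute)+
qed

section \<open>Covariance estimates with an exponential rate\<close>

text \<open>Truncation at height \<open>\<delta> powr (- m)\<close> leaves the error
  \<open>\<delta> powr (\<epsilon> * m)\<close>. The two conditions on \<open>m\<close> bring this
  and the mixing term down to \<open>\<delta> powr (\<eta> * k)\<close>; \<open>L\<close> is what
  remains of \<open>K\<close>, which may itself grow with an index.\<close>

lemma covariance_le_rate:
  fixes h :: "(nat \<Rightarrow> 'x) \<Rightarrow> real" and n k :: nat
  defines "H \<equiv> \<lambda>x. h (tail_map X n x)"
  assumes "s \<in> B" "N s \<le> K" "0 \<le> K" "h \<in> borel_measurable (tail_space XX n)"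
    and sH: "integrable \<mu> (\<lambda>x. s x * H x)" and iH: "integrable \<mu> H"
    and sHe: "integrable \<mu> (\<lambda>x. \<bar>s x\<bar> * \<bar>H x\<bar> powr (1 + \<epsilon>))"
      "(\<integral>x. \<bar>s x\<bar> * \<bar>H x\<bar> powr (1 + \<epsilon>) \<partial>\<mu>) \<le> env k"
    and He: "integrable \<mu> (\<lambda>x. \<bar>H x\<bar> powr (1 + \<epsilon>))" "(\<integral>x. \<bar>H x\<bar> powr (1 + \<epsilon>) \<partial>\<mu>) \<le> env k"
    and s: "\<bar>\<integral>x. s x \<partial>\<mu>\<bar> \<le> env k"
    and m: "K * (\<delta> powr (- m) * \<delta> ^ n) \<le> L * \<delta> powr (\<eta> * real k)" "\<eta> * real k \<le> \<epsilon> * m" and L: "0 \<le> L"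
  shows "\<bar>(\<integral>x. s x * H x \<partial>\<mu>) - (\<integral>x. s x \<partial>\<mu>) * (\<integral>x. H x \<partial>\<mu>)\<bar>
     \<le> (L * C1 + 2) * (\<delta> powr (\<eta> * real k) * (env k)\<^sup>2)"
proof -
  let ?q = "\<delta> powr (\<eta> * real k)"
  note e = env_ge_1[of k]
  have q: "\<delta> powr (\<epsilon> * m) \<le> ?q" using \<delta> m by (intro powr_mono') auto
  have e2: "1 \<le> (env k)\<^sup>2" "env k \<le> (env k)\<^sup>2" using e by (auto simp: power2_eq_square mult_ge1_I)
  have "\<bar>(\<integral>x. s x * H x \<partial>\<mu>) - (\<integral>x. s x \<partial>\<mu>) * (\<integral>x. H x \<partial>\<mu>)\<bar>
     \<le> K * \<delta> powr (- m) * (C1 * \<delta> ^ n)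
        + (\<delta> powr (- m)) powr (- \<epsilon>) * ((\<integral>x. \<bar>s x\<bar> * \<bar>H x\<bar> powr (1 + \<epsilon>) \<partial>\<mu>)
          + \<bar>\<integral>x. s x \<partial>\<mu>\<bar> * (\<integral>x. \<bar>H x\<bar> powr (1 + \<epsilon>) \<partial>\<mu>))"
    using assms \<epsilon>_pos \<delta> unfolding H_def by (intro covariance_bound_unbounded) auto
  also have "(\<delta> powr (- m)) powr (- \<epsilon>) = \<delta> powr (\<epsilon> * m)" by (simp add: powr_powr mult.commute)
  also have "\<delta> powr (\<epsilon> * m) * ((\<integral>x. \<bar>s x\<bar> * \<bar>H x\<bar> powr (1 + \<epsilon>) \<partial>\<mu>)
          + \<bar>\<integral>x. s x \<partial>\<mu>\<bar> * (\<integral>x. \<bar>H x\<bar> powr (1 + \<epsilon>) \<partial>\<mu>)) \<le> ?q * (env k + env k * env k)"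
    using q e sHe He s by (intro mult_mono add_mono) (auto intro!: add_nonneg_nonneg)
  \<comment> \<open>Since \<open>1 \<le> env k\<close>, both summands are at most the square; this
    is the 2 in \<open>L * C1 + 2\<close>.\<close>
  also have "\<dots> \<le> ?q * (2 * (env k)\<^sup>2)"
    using e2 by (intro mult_left_mono) (auto simp: power2_eq_square)
  also have "K * \<delta> powr (- m) * (C1 * \<delta> ^ n) = C1 * (K * (\<delta> powr (- m) * \<delta> ^ n))" by simp
  also have "\<dots> \<le> C1 * (L * ?q)" using C1 m by (intro mult_left_mono) auto
  also have "\<dots> \<le> C1 * (L * ?q) * (env k)\<^sup>2"
    using e2 C1 L mult_left_mono[of 1 "(env k)\<^sup>2" "C1 * (L * ?q)"] by simp
  finally show ?thesis by (simp add: algebra_simps)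
qed

lemma \<eta>_le: "0 < \<eta>" "\<eta> \<le> 1 / 4" "\<eta> \<le> \<epsilon> / 4" "\<eta> \<le> 1 / (4 * a)" "\<eta> \<le> \<epsilon> / (4 * a)"
proof -
  have pos: "0 < min 1 \<epsilon>" "0 < min (1 / 4) (1 / (4 * a))" using \<epsilon>_pos a by auto
  show "0 < \<eta>" unfolding \<eta>_def using pos by simp
  show "\<eta> \<le> 1 / 4" "\<eta> \<le> 1 / (4 * a)"
    using mult_mono[of "min 1 \<epsilon>" 1 "min (1 / 4) (1 / (4 * a))" "1 / 4"]
      mult_mono[of "min 1 \<epsilon>" 1 "min (1 / 4) (1 / (4 * a))" "1 / (4 * a)"] pos by (auto simp: \<eta>_def)
  show "\<eta> \<le> \<epsilon> / 4" "\<eta> \<le> \<epsilon> / (4 * a)"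
    using mult_mono[of "min 1 \<epsilon>" \<epsilon> "min (1 / 4) (1 / (4 * a))" "1 / 4"]
      mult_mono[of "min 1 \<epsilon>" \<epsilon> "min (1 / 4) (1 / (4 * a))" "1 / (4 * a)"] pos \<epsilon>_pos by (auto simp: \<eta>_def)
qed

text \<open>For the later use of \<open>r * G j\<close> as the function \<open>s\<close> in (DC):
  its mean, unlike that of \<open>G j\<close>, need not vanish.\<close>

lemma G_density_mean_le: "\<bar>\<integral>x. r x * G k x \<partial>\<mu>\<bar> \<le> env k"
proof -
  have "\<bar>\<integral>x. r x * G k x \<partial>\<mu>\<bar> \<le> (\<integral>x. \<bar>r x * G k x\<bar> \<partial>\<mu>)" by (rule integral_abs_bound)
  also have "\<dots> \<le> env k"
    using moment(2)[of k k 1 1 True False] \<epsilon>_exponents by (simp add: abs_mult)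
  finally show ?thesis .
qed

text \<open>As \<open>r\<close> has integral 1 and \<open>G k\<close> is centered, the integral is a
  covariance of \<open>r\<close> and \<open>G k\<close>. Height
  \<open>\<delta> powr (- k / 2)\<close> leaves half of the decay
  \<open>\<delta> ^ k\<close>.\<close>

lemma density_mean_le_rate: "\<bar>\<integral>x. r x * G k x \<partial>\<mu>\<bar> \<le> rate k"
proof -
  have "\<bar>(\<integral>x. r x * g k (tail_map X k x) \<partial>\<mu>) - (\<integral>x. r x \<partial>\<mu>) * (\<integral>x. g k (tail_map X k x) \<partial>\<mu>)\<bar>
      \<le> (\<bar>N r\<bar> * C1 + 2) * (\<delta> powr (\<eta> * real k) * (env k)\<^sup>2)"
  proof (rule covariance_le_rate[where K="\<bar>N r\<bar>" and m = "real k / 2"])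
    show "\<bar>N r\<bar> * (\<delta> powr - (real k / 2) * \<delta> ^ k) \<le> \<bar>N r\<bar> * \<delta> powr (\<eta> * real k)"
      using \<delta> mult_right_mono[OF \<eta>_le(2), of "real k"]
      by (auto simp flip: powr_realpow powr_add intro!: mult_left_mono powr_mono')
    have "\<eta> * real k \<le> \<epsilon> / 4 * real k" using \<eta>_le(3) by (intro mult_right_mono) auto
    also have "\<dots> \<le> \<epsilon> * (real k / 2)" using \<epsilon>_pos by simp
    finally show "\<eta> * real k \<le> \<epsilon> * (real k / 2)" .
  qed (use moment[of k k 1 "1 + \<epsilon>" True False] moment[of k k 1 "1 + \<epsilon>" False False]
       \<epsilon>_exponents \<epsilon>_pos env_ge_1 r_B integrable_products in
       \<open>auto simp: r_int simp flip: tail_obs_def\<close>)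
  hence "\<bar>\<integral>x. r x * G k x \<partial>\<mu>\<bar> \<le> (\<bar>N r\<bar> * C1 + 2) * (\<delta> powr (\<eta> * real k) * (env k)\<^sup>2)"
    by (simp add: centered flip: tail_obs_def)
  also have "\<dots> \<le> rate k" unfolding rate_def using b C1 by (intro mult_right_mono) auto
  finally show ?thesis .
qed

text \<open>For \<open>a j \<le> k / 2\<close> both integrals are small, by mixing between times \<open>j\<close> and \<open>k\<close>;
  otherwise \<open>j\<close> is itself of order \<open>k\<close>, and mixing between \<open>r\<close> and time \<open>j\<close> applies to \<open>G j * G k\<close>.\<close>

lemma density_covariance_le_rate:
  assumes "j \<le> k"
  shows "\<bar>(\<integral>x. G j x * G k x \<partial>\<mu>) - (\<integral>x. r x * (G j x * G k x) \<partial>\<mu>)\<bar> \<le> rate k"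
proof (cases "a * real j \<le> real k / 2")
  case True
  \<comment> \<open>The norm costs at most \<open>\<delta> powr (- k / 2)\<close>, as
    \<open>a * j \<le> k / 2\<close>, and the truncation \<open>\<delta> powr (- k / 4)\<close>; a
    quarter of the decay \<open>\<delta> ^ k\<close> is left.\<close>
  have m: "b * \<delta> powr (- (a * real j)) * (\<delta> powr - (real k / 4) * \<delta> ^ k) \<le> b * \<delta> powr (\<eta> * real k)"
    using \<delta> b True mult_right_mono[OF \<eta>_le(2), of "real k"]
    by (auto simp flip: powr_realpow powr_add simp: mult.assoc intro!: mult_left_mono powr_mono')
  have m': "\<eta> * real k \<le> \<epsilon> * (real k / 4)"
    using mult_right_mono[OF \<eta>_le(3), of "real k"] by simp
  have "\<bar>(\<integral>x. G j x * g k (tail_map X k x) \<partial>\<mu>) - (\<integral>x. G j x \<partial>\<mu>) * (\<integral>x. g k (tail_map X k x) \<partial>\<mu>)\<bar>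
      \<le> (b * C1 + 2) * (\<delta> powr (\<eta> * real k) * (env k)\<^sup>2)"
    by (rule covariance_le_rate[OF G_B N_bound(1) _ _ _ _ _ _ _ _ _ m m'])
     (use assms moment[of j k 1 "1 + \<epsilon>" False True] moment[of k k 1 "1 + \<epsilon>" False False]
       \<epsilon>_exponents \<epsilon>_pos env_ge_1[of k] integrable_products b in
       \<open>auto simp: centered simp flip: tail_obs_def\<close>)
  hence 1: "\<bar>\<integral>x. G j x * G k x \<partial>\<mu>\<bar> \<le> (b * C1 + 2) * (\<delta> powr (\<eta> * real k) * (env k)\<^sup>2)"
    by (simp add: centered flip: tail_obs_def)
  have "env j \<le> env k"
    unfolding env_def using assms p c0 \<beta> 
    by (intro mult_left_mono) (auto intro!: add_nonneg_nonneg mult_left_mono powr_mono2)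
  hence rG: "\<bar>\<integral>x. r x * G j x \<partial>\<mu>\<bar> \<le> env k" using G_density_mean_le[of j] by simp
  \<comment> \<open>With \<open>r * G j\<close> as the function \<open>s\<close>, the product of
    means still vanishes because \<open>G k\<close> is centered under \<open>\<mu>\<close>.\<close>
  have "\<bar>(\<integral>x. r x * G j x * g k (tail_map X k x) \<partial>\<mu>)
        - (\<integral>x. r x * G j x \<partial>\<mu>) * (\<integral>x. g k (tail_map X k x) \<partial>\<mu>)\<bar>
      \<le> (b * C1 + 2) * (\<delta> powr (\<eta> * real k) * (env k)\<^sup>2)"
    by (rule covariance_le_rate[OF rG_B N_bound(2) _ _ _ _ _ _ _ _ rG m m'])
     (use assms moment[of j k 1 "1 + \<epsilon>" True True] moment[of k k 1 "1 + \<epsilon>" False False]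
       \<epsilon>_exponents \<epsilon>_pos env_ge_1[of k] integrable_products b in
       \<open>auto simp: abs_mult mult.assoc simp flip: tail_obs_def\<close>)
  hence 2: "\<bar>\<integral>x. r x * (G j x * G k x) \<partial>\<mu>\<bar> \<le> (b * C1 + 2) * (\<delta> powr (\<eta> * real k) * (env k)\<^sup>2)"
    by (simp add: centered mult.assoc flip: tail_obs_def)
  have "0 \<le> (\<bar>N r\<bar> * C1 + 2) * (\<delta> powr (\<eta> * real k) * (env k)\<^sup>2)" using C1 by simp
  with 1 2 show ?thesis unfolding rate_def distrib_right mult_2 by linarith
next
  case False
  \<comment> \<open>Half of the decay \<open>\<delta> ^ j\<close> will be spent on truncation; the
    remaining exponent \<open>j / 2\<close> is still at least \<open>k / (4 * a)\<close>.\<close>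
  hence jk: "1 / (4 * a) * real k \<le> real j / 2" using a by (simp add: field_simps)
  \<comment> \<open>The product becomes a single observable on the tail space from time
    \<open>j\<close>, so (DC) applies to it with \<open>s = r\<close>.\<close>
  define h where "h y = g j y * g k (\<lambda>i. y (k - j + i))" for y
  have [measurable]: "h \<in> borel_measurable (tail_space XX j)"
    unfolding h_def using assms by measurable
  have h: "h (tail_map X j x) = G j x * G k x" for x
    by (simp add: h_def G_of_tail[OF assms]) (simp add: tail_obs_def)
  have "\<bar>(\<integral>x. r x * h (tail_map X j x) \<partial>\<mu>) - (\<integral>x. r x \<partial>\<mu>) * (\<integral>x. h (tail_map X j x) \<partial>\<mu>)\<bar>
      \<le> (\<bar>N r\<bar> * C1 + 2) * (\<delta> powr (\<eta> * real k) * (env k)\<^sup>2)"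
  proof (rule covariance_le_rate[where K="\<bar>N r\<bar>" and m = "real j / 2"])
    have "\<eta> * real k \<le> real j / 2"
      using mult_right_mono[OF \<eta>_le(4), of "real k"] jk by linarith
    thus "\<bar>N r\<bar> * (\<delta> powr - (real j / 2) * \<delta> ^ j) \<le> \<bar>N r\<bar> * \<delta> powr (\<eta> * real k)"
      using \<delta> by (auto simp flip: powr_realpow powr_add intro!: mult_left_mono powr_mono')
    have "\<eta> * real k \<le> \<epsilon> * (1 / (4 * a) * real k)"
      using mult_right_mono[OF \<eta>_le(5), of "real k"] by simp
    also have "\<dots> \<le> \<epsilon> * (real j / 2)" using jk \<epsilon>_pos by (intro mult_left_mono) auto
    finally show "\<eta> * real k \<le> \<epsilon> * (real j / 2)" .
  qed (use assms moment[of j k "1 + \<epsilon>" "1 + \<epsilon>" True True] moment[of j k "1 + \<epsilon>" "1 + \<epsilon>" False True]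
       \<epsilon>_exponents \<epsilon>_pos env_ge_1 r_B integrable_products in
       \<open>auto simp: r_int h abs_mult powr_mult mult.assoc\<close>)
  hence "\<bar>(\<integral>x. G j x * G k x \<partial>\<mu>) - (\<integral>x. r x * (G j x * G k x) \<partial>\<mu>)\<bar>
      \<le> (\<bar>N r\<bar> * C1 + 2) * (\<delta> powr (\<eta> * real k) * (env k)\<^sup>2)"
    by (simp add: h r_int abs_minus_commute)
  also have "\<dots> \<le> rate k" unfolding rate_def using b C1 by (intro mult_right_mono) auto
  finally show ?thesis .
qed

section \<open>Summation over times\<close>

lemma rate_nonneg: "0 \<le> rate k"
  unfolding rate_def using b C1 by simp

text \<open>\<open>\<delta> powr (\<eta> * k)\<close> decays exponentially because
  \<open>ln \<delta> < 0\<close>, while \<open>env\<close> grows only like the exponential of a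
  multiple of \<open>k powr \<beta>\<close>.\<close>

lemma summable_rate: "summable (\<lambda>k. (2 * real k + 1) * rate k)"
proof -
  define A where "A = 3 + (\<integral>x. \<bar>r x\<bar> powr p \<partial>\<mu>) + 2 * C0 powr p"
  define A' where "A' = 2 * (b * C1 + 2) + (\<bar>N r\<bar> * C1 + 2)"
  have "summable (\<lambda>k::nat. 2 * A' * A\<^sup>2 * ((real k + 1) * (exp (- (- \<eta> * ln \<delta>) * real k) * exp (2 * p * c0 * real k powr \<beta>))))"
    using \<eta>_le(1) \<delta> \<beta> p c0
    by (intro summable_mult summable_linear_times_subexponential) (auto simp: mult_pos_neg)
  \<comment> \<open>The weight is enlarged to \<open>2 * k + 2\<close>, twice the linear factor of
    the comparison series.\<close>
  moreover have "2 * A' * A\<^sup>2 * ((real k + 1) * (exp (- (- \<eta> * ln \<delta>) * real k) * exp (2 * p * c0 * real k powr \<beta>)))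
      = (2 * real k + 2) * rate k" for k
  proof -
    have "exp (2 * p * c0 * real k powr \<beta>) = (exp (p * c0 * real k powr \<beta>))\<^sup>2"
      by (simp add: exp_double[symmetric] mult.assoc)
    thus ?thesis unfolding rate_def env_def A_def[symmetric] A'_def[symmetric] using \<delta>
      by (simp add: powr_def power_mult_distrib algebra_simps)
  qed
  ultimately have "summable (\<lambda>k. (2 * real k + 2) * rate k)" by (simp only:)
  thus ?thesis
    by (rule summable_comparison_test'[where N=0])
       (auto simp: abs_mult rate_nonneg intro!: mult_right_mono)
qed

lemma sum_rate_le: "(\<Sum>k<n. (2 * real k + 1) * rate k) \<le> total_rate"
  unfolding total_rate_def using summable_rate rate_nonneg by (intro sum_le_suminf) auto

lemma S_square: "(S n x)\<^sup>2 = (\<Sum>j<n. \<Sum>k<n. G j x * G k x)"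
  unfolding partial_sum_def power2_eq_square sum_product ..

lemma integrable_S: "integrable \<mu> (S n)" "integrable \<mu> (\<lambda>x. r x * S n x)"
  "integrable \<mu> (\<lambda>x. (S n x)\<^sup>2)" "integrable \<mu> (\<lambda>x. r x * (S n x)\<^sup>2)"
proof -
  show "integrable \<mu> (S n)" "integrable \<mu> (\<lambda>x. r x * S n x)"
    unfolding partial_sum_def[abs_def] sum_distrib_left
    using integrable_products by (auto intro!: Bochner_Integration.integrable_sum)
  show "integrable \<mu> (\<lambda>x. (S n x)\<^sup>2)" "integrable \<mu> (\<lambda>x. r x * (S n x)\<^sup>2)"
    unfolding S_square sum_distrib_left
    using integrable_products by (auto intro!: Bochner_Integration.integrable_sum)
qed

lemma S_mean: "(\<integral>x. S n x \<partial>\<mu>) = 0"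
  unfolding partial_sum_def using integrable_products
  by (subst Bochner_Integration.integral_sum) (auto simp: centered)

lemma S_density_mean_le: "\<bar>\<integral>x. r x * S n x \<partial>\<mu>\<bar> \<le> total_rate"
proof -
  have "(\<integral>x. r x * S n x \<partial>\<mu>) = (\<Sum>k<n. \<integral>x. r x * G k x \<partial>\<mu>)"
    unfolding partial_sum_def sum_distrib_left using integrable_products
    by (subst Bochner_Integration.integral_sum) auto
  also have "\<bar>\<dots>\<bar> \<le> (\<Sum>k<n. rate k)"
    by (rule order_trans[OF sum_abs sum_mono]) (rule density_mean_le_rate)
  \<comment> \<open>Inserting a weight of at least 1 lets the means share the constant
    \<open>total_rate\<close>.\<close>
  also have "\<dots> \<le> (\<Sum>k<n. (2 * real k + 1) * rate k)"
    using rate_nonneg by (intro sum_mono) (simp add: algebra_simps)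
  also note sum_rate_le
  finally show ?thesis .
qed

lemma S_density_second_moment_le:
  "\<bar>(\<integral>x. (S n x)\<^sup>2 \<partial>\<mu>) - (\<integral>x. r x * (S n x)\<^sup>2 \<partial>\<mu>)\<bar> \<le> total_rate"
proof -
  let ?d = "\<lambda>j k. (\<integral>x. G j x * G k x \<partial>\<mu>) - (\<integral>x. r x * (G j x * G k x) \<partial>\<mu>)"
  \<comment> \<open>The estimate was proved for ordered indices; the product
    \<open>G j * G k\<close> is symmetric.\<close>
  have d: "\<bar>?d j k\<bar> \<le> rate (max j k)" for j k
    using density_covariance_le_rate[of j k] density_covariance_le_rate[of k j]
    by (cases "j \<le> k") (auto simp: max_def mult.commute)
  have "(\<integral>x. (S n x)\<^sup>2 \<partial>\<mu>) - (\<integral>x. r x * (S n x)\<^sup>2 \<partial>\<mu>) = (\<Sum>j<n. \<Sum>k<n. ?d j k)"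
    unfolding S_square sum_distrib_left
    using integrable_products
    by (simp add: Bochner_Integration.integral_sum Bochner_Integration.integrable_sum sum_subtractf)
  also have "\<bar>\<dots>\<bar> \<le> (\<Sum>j<n. \<Sum>k<n. rate (max j k))"
    by (intro order_trans[OF sum_abs] sum_mono d)
  also have "\<dots> \<le> total_rate" unfolding sum_max_square by (rule sum_rate_le)
  finally show ?thesis .
qed

section \<open>The measure \<open>\<nu>\<close> and the variance gap\<close>

lemma sets_\<nu> [measurable_cong, simp]: "sets \<nu> = sets \<mu>"
  by (simp add: \<nu>_def)

lemma prob_space_\<nu>: "prob_space \<nu>"
proof (rule prob_spaceI)
  have "emeasure \<nu> (space \<nu>) = (\<integral>\<^sup>+x. ennreal (r x) \<partial>\<mu>)"
    unfolding \<nu>_def by (subst emeasure_density) (auto intro!: nn_integral_cong)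
  also have "\<dots> = ennreal (\<integral>x. r x \<partial>\<mu>)"
    using integrable_B[OF r_B] r_nonneg by (rule nn_integral_eq_integral)
  finally show "emeasure \<nu> (space \<nu>) = 1" by (simp add: r_int)
qed

lemma integral_\<nu>:
  fixes f :: "'e \<Rightarrow> 'b::{banach, second_countable_topology}"
  assumes "f \<in> borel_measurable \<mu>"
  shows "(\<integral>x. f x \<partial>\<nu>) = (\<integral>x. r x *\<^sub>R f x \<partial>\<mu>)"
  unfolding \<nu>_def using assms r_nonneg by (intro integral_density) auto

lemma integrable_\<nu>:
  fixes f :: "'e \<Rightarrow> 'b::{banach, second_countable_topology}"
  assumes "f \<in> borel_measurable \<mu>"
  shows "integrable \<nu> f \<longleftrightarrow> integrable \<mu> (\<lambda>x. r x *\<^sub>R f x)"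
  unfolding \<nu>_def using assms r_nonneg by (intro integrable_density) auto

lemma integrable_S_\<nu>: "integrable \<nu> (S n)" "integrable \<nu> (\<lambda>x. (S n x)\<^sup>2)"
  using integrable_S by (simp_all add: integrable_\<nu>)

lemma total_rate_nonneg: "0 \<le> total_rate"
  using sum_rate_le[of 0] by simp

lemma mean_\<nu>_le: "\<bar>\<integral>x. S n x \<partial>\<nu>\<bar> \<le> total_rate"
  using S_density_mean_le by (simp add: integral_\<nu>)

lemma second_moment_gap_le: "\<bar>(\<integral>x. (S n x)\<^sup>2 \<partial>\<mu>) - (\<integral>x. (S n x)\<^sup>2 \<partial>\<nu>)\<bar> \<le> total_rate"
  using S_density_second_moment_le by (simp add: integral_\<nu>)

lemma variance_\<mu>: "variance (S n) = (\<integral>x. (S n x)\<^sup>2 \<partial>\<mu>)"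
  by (simp add: S_mean)

lemma variance_\<nu>: "prob_space.variance \<nu> (S n) = (\<integral>x. (S n x)\<^sup>2 \<partial>\<nu>) - (\<integral>x. S n x \<partial>\<nu>)\<^sup>2"
  using prob_space.variance_eq[OF prob_space_\<nu> integrable_S_\<nu>] by simp

text \<open>The mean under \<open>\<mu>\<close> vanishes, so the variances differ by the gap of
  second moments plus the squared mean under \<open>\<nu>\<close>.\<close>

lemma variance_gap_le: "\<bar>variance (S n) - prob_space.variance \<nu> (S n)\<bar> \<le> total_rate + total_rate\<^sup>2"
proof -
  have "(\<integral>x. S n x \<partial>\<nu>)\<^sup>2 \<le> total_rate\<^sup>2"
    using power_mono[OF mean_\<nu>_le[of n], of 2] by simp
  moreover have "0 \<le> (\<integral>x. S n x \<partial>\<nu>)\<^sup>2" by simp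
  ultimately show ?thesis
    using second_moment_gap_le[of n] unfolding variance_\<mu> variance_\<nu> by linarith
qed

section \<open>Merging of characteristic functions and limit laws\<close>

text \<open>Dropping the first \<open>m\<close> summands costs \<open>\<bar>c\<bar>\<close> times
  the first absolute moment of \<open>S m\<close> under each measure. What remains depends only on
  the tail from time \<open>m\<close>, where (DC) compares \<open>r\<close> with its mean 1.\<close>

lemma fourier_gap_le:
  assumes "m \<le> n"
  shows "cmod ((\<integral>x. iexp (c * S n x) \<partial>\<nu>) - (\<integral>x. iexp (c * S n x) \<partial>\<mu>))
    \<le> \<bar>c\<bar> * ((\<integral>x. \<bar>S m x\<bar> \<partial>\<nu>) + (\<integral>x. \<bar>S m x\<bar> \<partial>\<mu>)) + \<bar>N r\<bar> * C1 * \<delta> ^ m"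
proof -
  define h where "h y = (\<Sum>k\<in>{m..<n}. g k (\<lambda>i. y (k - m + i)))" for y
  have [measurable]: "h \<in> borel_measurable (tail_space XX m)"
    unfolding h_def by (intro borel_measurable_sum G_of_tail_measurable) simp
  define Z where "Z x = h (tail_map X m x)" for x
  have [measurable]: "Z \<in> borel_measurable \<mu>" unfolding Z_def by measurable
  have "S n x = S m x + (\<Sum>k\<in>{m..<n}. G k x)" for x
    unfolding partial_sum_def using assms
    by (simp add: atLeast0LessThan[symmetric] sum.atLeastLessThan_concat)
  also have "(\<Sum>k\<in>{m..<n}. G k x) = Z x" for x
    unfolding Z_def h_def by (intro sum.cong refl G_of_tail) simp
  finally have SZ: "S n x = S m x + Z x" for x .
  have drop: "cmod ((\<integral>x. iexp (c * S n x) \<partial>P) - (\<integral>x. iexp (c * Z x) \<partial>P)) \<le> \<bar>c\<bar> * (\<integral>x. \<bar>S m x\<bar> \<partial>P)"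
    if "prob_space P" "sets P = sets \<mu>" "integrable P (S m)" for P
  proof -
    interpret P: prob_space P by fact
    note [measurable_cong] = that(2)
    have "cmod ((\<integral>x. iexp (c * S n x) \<partial>P) - (\<integral>x. iexp (c * Z x) \<partial>P)) \<le> (\<integral>x. \<bar>c * S n x - c * Z x\<bar> \<partial>P)"
      using that(3) by (intro P.expectation_iexp_diff_le) (auto simp: SZ algebra_simps)
    also have "\<dots> = \<bar>c\<bar> * (\<integral>x. \<bar>S m x\<bar> \<partial>P)" by (simp add: SZ distrib_left abs_mult)
    finally show ?thesis .
  qed
  \<comment> \<open>The observable \<open>iexp (c * h y)\<close> has modulus 1, so its bound does
    not depend on \<open>n\<close> or \<open>c\<close>.\<close>
  have "cmod ((\<integral>x. of_real (r x) * iexp (c * h (tail_map X m x)) \<partial>\<mu>)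
           - of_real (\<integral>x. r x \<partial>\<mu>) * (\<integral>x. iexp (c * h (tail_map X m x)) \<partial>\<mu>)) \<le> \<bar>N r\<bar> * 1 * (C1 * \<delta> ^ m)"
    by (intro covariance_bound[OF r_B]) auto
  hence "cmod ((\<integral>x. iexp (c * Z x) \<partial>\<nu>) - (\<integral>x. iexp (c * Z x) \<partial>\<mu>)) \<le> \<bar>N r\<bar> * C1 * \<delta> ^ m"
    by (simp add: integral_\<nu> r_int scaleR_conv_of_real Z_def mult.assoc)
  moreover note drop[OF prob_space_\<nu> sets_\<nu> integrable_S_\<nu>(1)] drop[OF prob_space_axioms refl integrable_S(1)]
  moreover have "cmod (A - A') \<le> cmod (A - D) + cmod (A' - D') + cmod (D - D')" for A A' D D'
    using norm_triangle_ineq4[of "(A - D)" "(A' - D')"] norm_triangle_ineq[of "A - D - (A' - D')" "D - D'"]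
    by simp
  ultimately show ?thesis unfolding distrib_left by (smt (verit))
qed

text \<open>First \<open>m\<close> is fixed so that the mixing error is below \<open>e / 2\<close>;
  then \<open>J\<close> is a constant, and \<open>t / \<sigma> n\<close> tends to 0.\<close>

lemma fourier_gap_tendsto_0:
  assumes lim: "filterlim \<sigma> at_top sequentially"
  shows "(\<lambda>n. (\<integral>x. iexp (t * (S n x / \<sigma> n)) \<partial>\<nu>) - (\<integral>x. iexp (t * (S n x / \<sigma> n)) \<partial>\<mu>)) \<longlonglongrightarrow> 0"
proof (rule tendstoI)
  fix e :: real assume e: "0 < e"
  have "(\<lambda>m. \<bar>N r\<bar> * C1 * \<delta> ^ m) \<longlonglongrightarrow> 0"
    using \<delta> by (intro tendsto_mult_right_zero LIMSEQ_power_zero) auto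
  from order_tendstoD(2)[OF this, of "e / 2"] e
  obtain m where m: "\<bar>N r\<bar> * C1 * \<delta> ^ m < e / 2" by (auto simp: eventually_sequentially)
  define J where "J = (\<integral>x. \<bar>S m x\<bar> \<partial>\<nu>) + (\<integral>x. \<bar>S m x\<bar> \<partial>\<mu>)"
  have "(\<lambda>n. \<bar>t / \<sigma> n\<bar> * J) \<longlonglongrightarrow> 0"
    by (intro tendsto_mult_left_zero tendsto_rabs_zero real_tendsto_divide_at_top[OF tendsto_const lim])
  from order_tendstoD(2)[OF this, of "e / 2"] e
  have "\<forall>\<^sub>F n in sequentially. \<bar>t / \<sigma> n\<bar> * J < e / 2" by simp
  thus "\<forall>\<^sub>F n in sequentially.
     dist ((\<integral>x. iexp (t * (S n x / \<sigma> n)) \<partial>\<nu>) - (\<integral>x. iexp (t * (S n x / \<sigma> n)) \<partial>\<mu>)) 0 < e"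
    using eventually_ge_at_top[of m]
  proof eventually_elim
    case (elim n)
    have "t / \<sigma> n * S n x = t * (S n x / \<sigma> n)" for x by simp
    with fourier_gap_le[OF elim(2), of "t / \<sigma> n"]
    have "cmod ((\<integral>x. iexp (t * (S n x / \<sigma> n)) \<partial>\<nu>) - (\<integral>x. iexp (t * (S n x / \<sigma> n)) \<partial>\<mu>))
        \<le> \<bar>t / \<sigma> n\<bar> * J + \<bar>N r\<bar> * C1 * \<delta> ^ m" by (simp only: J_def)
    with elim(1) m
    show ?case unfolding dist_norm diff_zero by linarith
  qed
qed

context
  assumes variance_at_top: "filterlim (\<lambda>n. sqrt (variance (S n))) at_top sequentially"
begin

lemma ratio_tendsto_1: "(\<lambda>n. sqrt (variance (S n)) / sqrt (prob_space.variance \<nu> (S n))) \<longlonglongrightarrow> 1"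
  by (rule sqrt_ratio_tendsto_1[OF variance_at_top variance_gap_le])

text \<open>Two replacements: from \<open>\<mu>\<close> to \<open>\<nu>\<close> with the common
  normalization \<open>S n / V n\<close>, by \<open>fourier_gap_tendsto_0\<close>; then, under
  \<open>\<nu>\<close>, to the own mean and deviation of \<open>\<nu>\<close>, which costs little
  since \<open>V n / W n\<close> tends to 1 and the means are bounded.\<close>

lemma char_gap_tendsto_0:
  "(\<lambda>n. char (standardized_law \<mu> (S n)) t - char (standardized_law \<nu> (S n)) t) \<longlonglongrightarrow> 0"
proof -
  interpret \<nu>: prob_space \<nu> by (rule prob_space_\<nu>)
  define V where "V n = sqrt (variance (S n))" for n
  define W where "W n = sqrt (\<nu>.variance (S n))" for n
  define m where "m n = \<nu>.expectation (S n)" for n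
  have V: "filterlim V at_top sequentially" unfolding V_def by (rule variance_at_top)
  have VW: "(\<lambda>n. V n / W n) \<longlonglongrightarrow> 1" unfolding V_def W_def by (rule ratio_tendsto_1)
  \<comment> \<open>Keeps the second moment of \<open>S n / V n\<close> under \<open>\<nu>\<close>
    bounded.\<close>
  have V2: "(\<integral>x. (S n x)\<^sup>2 \<partial>\<nu>) \<le> (V n)\<^sup>2 + total_rate" for n
  proof -
    have "(V n)\<^sup>2 = (\<integral>x. (S n x)\<^sup>2 \<partial>\<mu>)" unfolding V_def variance_\<mu> by simp
    thus ?thesis using second_moment_gap_le[of n] by simp
  qed
  have "(\<lambda>n. \<nu>.expectation (\<lambda>x. iexp (t * (S n x / V n)))
      - \<nu>.expectation (\<lambda>x. iexp (t * ((S n x - m n) / W n)))) \<longlonglongrightarrow> 0"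
  proof (rule Lim_null_comparison)
    let ?B = "\<lambda>n. \<bar>t\<bar> * ((1 + total_rate / V n / V n) * \<bar>1 - V n / W n\<bar> + total_rate / V n * \<bar>V n / W n\<bar>)"
    have 1: "(\<lambda>n. total_rate / V n) \<longlonglongrightarrow> 0" by (rule real_tendsto_divide_at_top[OF tendsto_const V])
    have 2: "(\<lambda>n. total_rate / V n / V n) \<longlonglongrightarrow> 0" by (rule real_tendsto_divide_at_top[OF 1 V])
    have "?B \<longlonglongrightarrow> \<bar>t\<bar> * ((1 + 0) * \<bar>1 - 1\<bar> + 0 * \<bar>1\<bar>)"
      by (intro tendsto_add tendsto_mult tendsto_rabs tendsto_diff tendsto_const 1 2 VW)
    thus "?B \<longlonglongrightarrow> 0" by simp
    show "\<forall>\<^sub>F n in sequentially. norm (\<nu>.expectation (\<lambda>x. iexp (t * (S n x / V n)))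
      - \<nu>.expectation (\<lambda>x. iexp (t * ((S n x - m n) / W n)))) \<le> ?B n"
      using filterlim_at_top_dense[THEN iffD1, OF V, rule_format, of 0]
    proof eventually_elim
      case (elim n)
      define q where "q = V n / W n"
      \<comment> \<open>This holds for \<open>W n = 0\<close> too: both sides are then 0, as
        division by 0 gives 0.\<close>
      have W: "x / W n = x / V n * q" for x using elim by (simp add: q_def)
      have diff: "\<bar>t * (S n x / V n) - t * ((S n x - m n) / W n)\<bar>
          \<le> \<bar>t\<bar> * ((1 + (S n x)\<^sup>2 / (V n)\<^sup>2) / 2 * \<bar>1 - q\<bar> + total_rate / V n * \<bar>q\<bar>)" for x
      proof -
        have "t * (S n x / V n) - t * ((S n x - m n) / W n)
          = t * (S n x / V n * (1 - q) + m n / V n * q)"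
          by (simp add: W field_simps diff_divide_distrib)
        \<comment> \<open>Expanding \<open>0 \<le> (\<bar>u\<bar> - 1)\<^sup>2\<close> bounds the
          absolute value by the square, whose integral \<open>V2\<close> controls.\<close>
        moreover have "\<bar>S n x / V n\<bar> \<le> (1 + (S n x)\<^sup>2 / (V n)\<^sup>2) / 2"
          using zero_le_power2[of "\<bar>S n x / V n\<bar> - 1"]
          by (simp add: power2_diff power_divide abs_mult mult.commute add.commute)
        moreover have "\<bar>m n / V n\<bar> \<le> total_rate / V n"
          using mean_\<nu>_le[of n] elim by (simp add: m_def divide_right_mono)
        ultimately show ?thesis
          by (auto simp only: abs_mult intro!: mult_left_mono order_trans[OF abs_triangle_ineq] add_mono mult_right_mono)
      qed
      have int: "integrable \<nu> (\<lambda>x. \<bar>t\<bar> * ((1 + (S n x)\<^sup>2 / (V n)\<^sup>2) / 2 * \<bar>1 - q\<bar> + total_rate / V n * \<bar>q\<bar>))"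
        using integrable_S_\<nu> by simp
      have "norm (\<nu>.expectation (\<lambda>x. iexp (t * (S n x / V n)))
          - \<nu>.expectation (\<lambda>x. iexp (t * ((S n x - m n) / W n))))
        \<le> \<nu>.expectation (\<lambda>x. \<bar>t * (S n x / V n) - t * ((S n x - m n) / W n)\<bar>)"
        using integrable_S_\<nu> by (intro \<nu>.expectation_iexp_diff_le) auto
      also have "\<dots> \<le> \<nu>.expectation (\<lambda>x. \<bar>t\<bar> * ((1 + (S n x)\<^sup>2 / (V n)\<^sup>2) / 2 * \<bar>1 - q\<bar> + total_rate / V n * \<bar>q\<bar>))"
        using integrable_S_\<nu> by (intro integral_mono int diff) auto
      also have "\<dots> = \<bar>t\<bar> * ((1 + \<nu>.expectation (\<lambda>x. (S n x)\<^sup>2) / (V n)\<^sup>2) / 2 * \<bar>1 - q\<bar> + total_rate / V n * \<bar>q\<bar>)"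
        using integrable_S_\<nu> by (simp add: \<nu>.prob_space)
      also have "\<dots> \<le> \<bar>t\<bar> * ((1 + total_rate / V n / V n) * \<bar>1 - q\<bar> + total_rate / V n * \<bar>q\<bar>)"
      proof (intro mult_left_mono add_mono mult_right_mono)
        have half: "(1 + x) / 2 \<le> 1 + y" if "x \<le> 1 + y" "0 \<le> y" for x y :: real
          using that by simp
        have "\<nu>.expectation (\<lambda>x. (S n x)\<^sup>2) / (V n)\<^sup>2 \<le> ((V n)\<^sup>2 + total_rate) / (V n)\<^sup>2"
          by (intro divide_right_mono V2) auto
        also have "\<dots> = 1 + total_rate / V n / V n"
          using elim by (simp add: add_divide_distrib power2_eq_square)
        finally have "\<nu>.expectation (\<lambda>x. (S n x)\<^sup>2) / (V n)\<^sup>2 \<le> 1 + total_rate / V n / V n" .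
        moreover have "0 \<le> total_rate / V n / V n" using total_rate_nonneg elim by simp
        ultimately show "(1 + \<nu>.expectation (\<lambda>x. (S n x)\<^sup>2) / (V n)\<^sup>2) / 2 \<le> 1 + total_rate / V n / V n"
          by (rule half)
      qed (use total_rate_nonneg elim in auto)
      finally show ?case by (simp add: q_def)
    qed
  qed
  \<comment> \<open>The terms with \<open>S n / V n\<close> under \<open>\<nu>\<close> cancel. Since
    \<open>S n\<close> is centered under \<open>\<mu>\<close>, \<open>S n / V n\<close> is its
    standardization there.\<close>
  from tendsto_add[OF fourier_gap_tendsto_0[OF V, of t] tendsto_minus[OF this]]
  have "(\<lambda>n. \<nu>.expectation (\<lambda>x. iexp (t * ((S n x - m n) / W n)))
      - expectation (\<lambda>x. iexp (t * (S n x / V n)))) \<longlonglongrightarrow> 0" by (simp add: algebra_simps)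
  from tendsto_minus[OF this] show ?thesis
    by (simp add: char_standardized_law S_mean V_def W_def m_def)
qed

lemma weak_conv_standardized_law_iff:
  assumes "real_distribution L"
  shows "weak_conv_m (\<lambda>n. standardized_law \<mu> (S n)) L \<longleftrightarrow> weak_conv_m (\<lambda>n. standardized_law \<nu> (S n)) L"
proof -
  interpret \<nu>: prob_space \<nu> by (rule prob_space_\<nu>)
  show ?thesis
    by (intro weak_conv_m_iff_of_char_diff_tendsto_0 char_gap_tendsto_0 assms
        real_distribution_standardized_law \<nu>.real_distribution_standardized_law) measurable
qed

end

end

section \<open>Assembly with a single constant for both gaps\<close>

theorem proposition3p3:
  fixes \<mu> \<nu> :: "'e measure"
    and XX :: "nat \<Rightarrow> 'x measure"
    and X :: "nat \<Rightarrow> 'e \<Rightarrow> 'x"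
    and B :: "('e \<Rightarrow> real) set"
    and N :: "('e \<Rightarrow> real) \<Rightarrow> real"
    and \<delta>seq :: "nat \<Rightarrow> real"
    and g :: "nat \<Rightarrow> (nat \<Rightarrow> 'x) \<Rightarrow> real"
    and r :: "'e \<Rightarrow> real"
    and G S :: "nat \<Rightarrow> 'e \<Rightarrow> real"
    and C1 \<delta> a b c0 C0 \<beta> p :: real
  assumes "prob_space \<mu>"
    and "\<And>j. X j \<in> measurable \<mu> (XX j)"
    and "decay_of_correlations \<mu> XX X B N \<delta>seq"
    and "\<And>j. g j \<in> borel_measurable (tail_space XX j)"
    and "r \<in> B" and "AE x in \<mu>. 0 \<le> r x" and "(\<integral>x. r x \<partial>\<mu>) = 1"
    and "\<nu> = density \<mu> (\<lambda>x. ennreal (r x))"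
    and "G = tail_obs X g" and "S = partial_sum X g"
    and "\<And>k. (\<integral>x. G k x \<partial>\<mu>) = 0"
    and "C1 > 0" and "0 < \<delta>" and "\<delta> < 1" and "\<And>k. \<delta>seq k = C1 * \<delta> ^ k"
    and "\<And>k. G k \<in> B" and "\<And>k. (\<lambda>x. r x * G k x) \<in> B"
    and "a > 0" and "b > 0"
    and "\<And>k. max (N (G k)) (N (\<lambda>x. r x * G k x)) \<le> b * \<delta> powr (- (a * real k))"
    and "c0 > 0" and "C0 > 0" and "0 < \<beta>" and "\<beta> < 1" and "p > 3"
    and "\<And>k. Lp_norm \<mu> (ennreal p) (G k) \<le> ennreal (C0 * exp (c0 * real k powr \<beta>))"
    and "Lp_norm \<mu> (ennreal p) r < \<infinity>"
  shows "\<exists>C>0.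
     (\<forall>n\<ge>1. \<bar>prob_space.expectation \<mu> (\<lambda>x. (S n x)\<^sup>2) - prob_space.expectation \<nu> (\<lambda>x. (S n x)\<^sup>2)\<bar> \<le> C) \<and>
     (\<forall>(M :: nat \<Rightarrow> real) (p1 :: ennreal) (p2 :: real) (p3 :: real).
        (\<forall>j. M j > 0) \<and> p1 \<ge> 1 \<and> p2 \<ge> 1 \<and> p3 \<ge> 1 \<and>
        1 / p1 + 1 / ennreal p2 + 1 / ennreal p3 = 1 \<and> Lp_norm \<mu> p1 r < \<infinity> \<longrightarrow>
        (\<forall>n\<ge>1. ennreal \<bar>prob_space.variance \<mu> (S n) - prob_space.variance \<nu> (S n)\<bar>
                  \<le> ennreal C + (mean_bound \<mu> G \<delta>seq M p2 p3 n)\<^sup>2) \<and>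
        ((\<forall>\<epsilon>>0. \<forall>\<^sub>F n in sequentially.
             mean_bound \<mu> G \<delta>seq M p2 p3 n \<le> ennreal (\<epsilon> * sqrt (prob_space.variance \<mu> (S n)))) \<and>
         filterlim (\<lambda>n. sqrt (prob_space.variance \<mu> (S n))) at_top sequentially \<longrightarrow>
           (\<lambda>n. sqrt (prob_space.variance \<mu> (S n)) / sqrt (prob_space.variance \<nu> (S n))) \<longlonglongrightarrow> 1 \<and>
           (\<forall>L. real_distribution L \<longrightarrow>
              weak_conv_m (\<lambda>n. standardized_law \<mu> (S n)) L \<longleftrightarrow>
              weak_conv_m (\<lambda>n. standardized_law \<nu> (S n)) L)))"
proof -
  have \<delta>seq: "\<delta>seq = (\<lambda>k. C1 * \<delta> ^ k)" using assms(15) by auto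
  interpret exp_decaying_sums \<mu> XX X B N C1 \<delta> g r a b c0 C0 \<beta> p
  proof (intro exp_decaying_sums.intro decaying_process.intro)
    show "decaying_process_axioms \<mu> XX X B N (\<lambda>k. C1 * \<delta> ^ k)"
      using assms(2,3,12,13) by (auto intro!: decaying_process_axioms.intro simp: \<delta>seq)
    show "exp_decaying_sums_axioms \<mu> XX X B N C1 \<delta> g r a b c0 C0 \<beta> p"
      using assms(4-27) unfolding assms(9) by (intro exp_decaying_sums_axioms.intro) auto
  qed (rule assms(1))
  \<comment> \<open>The variable \<open>\<nu>\<close> of the theorem shadows the locale constant,
    hence the qualified name.\<close>
  have \<nu>_eq: "\<nu> = exp_decaying_sums.\<nu> \<mu> r" unfolding assms(8) \<nu>_def ..
  \<comment> \<open>The first two terms bound the variance gap and so cover the second-moment gap;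
    the 1 makes \<open>C\<close> positive.\<close>
  define C where "C = total_rate + total_rate\<^sup>2 + 1"
  have C: "0 < C" "total_rate \<le> C" "total_rate + total_rate\<^sup>2 \<le> C"
    using total_rate_nonneg by (auto simp: C_def add_nonneg_pos)
  show ?thesis
    unfolding assms(10) \<nu>_eq
  proof (intro exI[of _ C] conjI allI impI; (elim conjE)?)
    show "\<bar>expectation (\<lambda>x. (partial_sum X g n x)\<^sup>2) - (\<integral>x. (partial_sum X g n x)\<^sup>2 \<partial>exp_decaying_sums.\<nu> \<mu> r)\<bar> \<le> C" for n
      using second_moment_gap_le[of n] C by linarith
    fix M p1 p2 p3 n
    let ?S = "partial_sum X g n"
    \<comment> \<open>The squared mean under \<open>\<nu>\<close> is bounded by
      \<open>total_rate\<^sup>2\<close>, which is part of \<open>C\<close>; adding the square of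
      \<open>mean_bound\<close> only enlarges the right-hand side.\<close>
    have "ennreal \<bar>variance ?S - prob_space.variance (exp_decaying_sums.\<nu> \<mu> r) ?S\<bar> \<le> ennreal C"
      using variance_gap_le[of n] C by (intro ennreal_leI) linarith
    thus "ennreal \<bar>variance ?S - prob_space.variance (exp_decaying_sums.\<nu> \<mu> r) ?S\<bar>
        \<le> ennreal C + (mean_bound \<mu> G \<delta>seq M p2 p3 n)\<^sup>2"
      by (rule order_trans) simp
  qed (use C ratio_tendsto_1 weak_conv_standardized_law_iff in auto)
qed

end
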